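(* Suppose $X$ is a compactum and $\pi\chi(p,X)=\chi(q,X)$ for all $p,q\in X$. Then $\chi Nt(p,X)=\omega$ for some $p\in X$. In particular, if $X$ is a homogeneous compactum and $\pi\chi(X)=\chi(X)$, then $\chi Nt(X)=\omega$.
   Context: A compactum is a compact Hausdorff space. $\chi(p,X)$ and $\pi\chi(p,X)$ denote the character and $\pi$-character of $p$ in $X$; $\chi(X)$, $\pi\chi(X)$ are their suprema over $p\in X$. Families of open sets are ordered by inclusion; a poset is $\kappa^{\mathrm{op}}$-like if no element is below $\kappa$-many elements. $\chi Nt(p,X)$ is the least $\kappa\geq\omega$ such that $p$ has a $\kappa^{\mathrm{op}}$-like local base, and $\chi Nt(X)=\sup_{p\in X}\chi Nt(p,X)$. *)

theory Defs
  imports "HOL-Analysis.Analysis"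
begin

definition compactum :: "'a topology \<Rightarrow> bool" where
  "compactum X \<longleftrightarrow> compact_space X \<and> Hausdorff_space X"

definition local_base :: "'a topology \<Rightarrow> 'a \<Rightarrow> 'a set set \<Rightarrow> bool" where
  "local_base X p B \<longleftrightarrow>
     (\<forall>U\<in>B. openin X U \<and> p \<in> U) \<and>
     (\<forall>W. openin X W \<and> p \<in> W \<longrightarrow> (\<exists>U\<in>B. U \<subseteq> W))"

definition local_pi_base :: "'a topology \<Rightarrow> 'a \<Rightarrow> 'a set set \<Rightarrow> bool" where
  "local_pi_base X p B \<longleftrightarrow>
     (\<forall>U\<in>B. openin X U \<and> U \<noteq> {}) \<and>
     (\<forall>W. openin X W \<and> p \<in> W \<longrightarrow> (\<exists>U\<in>B. U \<subseteq> W))"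

text \<open>Cardinal |F| + omega (the usual convention making cardinal functions infinite).\<close>
definition card_plus_omega :: "'b set \<Rightarrow> ('b + nat) rel" where
  "card_plus_omega F = card_of (F <+> (UNIV :: nat set))"

definition pichar_eq_char :: "'a topology \<Rightarrow> 'a \<Rightarrow> 'a \<Rightarrow> bool" where
  "pichar_eq_char X p q \<longleftrightarrow>
     (\<exists>P B. local_pi_base X p P \<and> (\<forall>P'. local_pi_base X p P' \<longrightarrow> (card_of P, card_of P') \<in> ordLeq) \<and>
            local_base X q B \<and> (\<forall>B'. local_base X q B' \<longrightarrow> (card_of B, card_of B') \<in> ordLeq) \<and>
            (card_plus_omega P, card_plus_omega B) \<in> ordIso)"

definition pichar_space_le :: "'a topology \<Rightarrow> 'k set \<Rightarrow> bool" where
  "pichar_space_le X K \<longleftrightarrow>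
     (\<forall>p\<in>topspace X. \<exists>P. local_pi_base X p P \<and> (card_plus_omega P, card_of K) \<in> ordLeq)"

definition char_space_le :: "'a topology \<Rightarrow> 'k set \<Rightarrow> bool" where
  "char_space_le X K \<longleftrightarrow>
     (\<forall>p\<in>topspace X. \<exists>B. local_base X p B \<and> (card_plus_omega B, card_of K) \<in> ordLeq)"

text \<open>pi-chi(X) = chi(X): same cardinal upper bounds; the type nat \<times> 'a set is large
  enough to realise both suprema (each is at most omega * 2^|X|).\<close>
definition pichar_space_eq_char_space :: "'a topology \<Rightarrow> bool" where
  "pichar_space_eq_char_space X \<longleftrightarrow>
     (\<forall>K :: (nat \<times> 'a set) set. pichar_space_le X K \<longleftrightarrow> char_space_le X K)"

definition omega_op_like :: "'a set set \<Rightarrow> bool" where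
  "omega_op_like B \<longleftrightarrow> (\<forall>U\<in>B. finite {V\<in>B. U \<subseteq> V})"

definition chiNt_omega :: "'a topology \<Rightarrow> 'a \<Rightarrow> bool" where
  "chiNt_omega X p \<longleftrightarrow> (\<exists>B. local_base X p B \<and> omega_op_like B)"

definition homogeneous_space :: "'a topology \<Rightarrow> bool" where
  "homogeneous_space X \<longleftrightarrow>
     (\<forall>p\<in>topspace X. \<forall>q\<in>topspace X. \<exists>f. homeomorphic_map X X f \<and> f p = q)"

end

theory Submission
  imports Defs "HOL-Algebra.Free_Abelian_Groups"
begin

text \<open>
  Let \<open>\<kappa>\<close> be the common value of the \<open>\<pi>\<close>-characters and characters. If \<open>\<kappa>\<close> many neighbourhoods
  \<open>V k\<close> of \<open>p\<close> are such that every neighbourhood of \<open>p\<close> lies in only finitely many of them, then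
  intersecting them with the members of a local base of size \<open>\<kappa>\<close> gives a local base witnessing
  \<open>\<chi>Nt(p,X) = \<omega>\<close>.

  To find such a \<open>p\<close>, choose by recursion on \<open>k < \<kappa>\<close> finite open covers such that no nonempty
  set of the form \<open>X\<close> minus the closures of finitely many members of earlier covers is contained
  in the closure of a member of the \<open>k\<close>-th one; there are fewer than \<open>\<kappa>\<close> such open sets, so they
  are not a local \<open>\<pi>\<close>-base at any point, and compactness provides the cover. Finitely many members
  of distinct covers then never cover \<open>X\<close>. Let \<open>V p k\<close> be a member of the \<open>k\<close>-th cover containing
  \<open>p\<close>. If every \<open>p\<close> had a neighbourhood inside infinitely many \<open>V p k\<close>, finitely many of
  these neighbourhoods would cover \<open>X\<close>, and hence so would finitely many \<open>V p k\<close> with distinct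
  indices \<open>k\<close>.
\<close>

unbundle cardinal_syntax

section \<open>Local bases and local \<pi>-bases\<close>

lemma local_baseI:
  assumes "\<And>U. U \<in> B \<Longrightarrow> openin X U" "\<And>U. U \<in> B \<Longrightarrow> p \<in> U"
    and "\<And>W. openin X W \<Longrightarrow> p \<in> W \<Longrightarrow> \<exists>U\<in>B. U \<subseteq> W"
  shows "local_base X p B"
  using assms unfolding local_base_def by simp

lemma local_baseD:
  assumes "local_base X p B"
  shows "U \<in> B \<Longrightarrow> openin X U" "U \<in> B \<Longrightarrow> p \<in> U"
    and "openin X W \<Longrightarrow> p \<in> W \<Longrightarrow> \<exists>U\<in>B. U \<subseteq> W"
  using assms unfolding local_base_def by simp_all

lemma local_pi_baseI:
  assumes "\<And>U. U \<in> B \<Longrightarrow> openin X U" "\<And>U. U \<in> B \<Longrightarrow> U \<noteq> {}"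
    and "\<And>W. openin X W \<Longrightarrow> p \<in> W \<Longrightarrow> \<exists>U\<in>B. U \<subseteq> W"
  shows "local_pi_base X p B"
  using assms unfolding local_pi_base_def by simp

lemma local_pi_baseD:
  assumes "local_pi_base X p B"
  shows "U \<in> B \<Longrightarrow> openin X U" "U \<in> B \<Longrightarrow> U \<noteq> {}"
    and "openin X W \<Longrightarrow> p \<in> W \<Longrightarrow> \<exists>U\<in>B. U \<subseteq> W"
  using assms unfolding local_pi_base_def by simp_all

lemma local_base_imp_local_pi_base:
  assumes "local_base X p B"
  shows "local_pi_base X p B"
  using local_baseD[OF assms] by (intro local_pi_baseI) auto

text \<open>The relation \<open><o\<close> is well-founded and the nonempty open sets form a local
  \<pi>-base, so the \<pi>-character is attained.\<close>

lemma exists_minimal_local_pi_base: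
  "\<exists>P. local_pi_base X p P \<and> (\<forall>P'. local_pi_base X p P' \<longrightarrow> |P| \<le>o |P'| )"
proof -
  define Q where "Q = {|P| | P. local_pi_base X p P}"
  have "local_pi_base X p {U. openin X U \<and> U \<noteq> {}}"
    by (rule local_pi_baseI) auto
  then have "Q \<noteq> {}" unfolding Q_def by blast
  then obtain r where "r \<in> Q" and min: "\<And>r'. (r', r) \<in> ordLess \<Longrightarrow> r' \<notin> Q"
    using wfE_min[OF wf_ordLess] by (metis equals0I)
  then obtain P where P: "local_pi_base X p P" "r = |P|" unfolding Q_def by blast
  have "|P| \<le>o |P'|" if "local_pi_base X p P'" for P'
    using min[of "|P'|"] that P(2) not_ordLess_iff_ordLeq[OF card_of_Well_order card_of_Well_order]
    unfolding Q_def by blast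
  with P(1) show ?thesis by blast
qed

section \<open>Sufficient conditions for \<chi>Nt(p,X) = \<omega>\<close>

lemma chiNt_omega_if_finite_local_pi_base:
  assumes "Hausdorff_space X" "p \<in> topspace X" "local_pi_base X p P" "finite P"
  shows "chiNt_omega X p"
proof -
  \<comment> \<open>Otherwise every member of \<open>P\<close> has a point other than
    \<open>p\<close>; deleting these finitely many points leaves a neighbourhood of \<open>p\<close>
    that contains no member.\<close>
  have "openin X {p}"
  proof (rule ccontr)
    assume np: "\<not> openin X {p}"
    have "\<exists>x. x \<in> U \<and> x \<noteq> p" if "U \<in> P" for U
    proof (rule ccontr)
      assume "\<not> ?thesis"
      moreover have "openin X U" "U \<noteq> {}"
        using local_pi_baseD(1,2)[OF assms(3) that] .
      ultimately have "U = {p}" by blast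
      with np \<open>openin X U\<close> show False by blast
    qed
    then obtain x where x: "\<And>U. U \<in> P \<Longrightarrow> x U \<in> U \<and> x U \<noteq> p" by metis
    have "U \<subseteq> topspace X" if "U \<in> P" for U
      using local_pi_baseD(1)[OF assms(3) that] by (rule openin_subset)
    then have sub: "x ` P \<subseteq> topspace X" using x by blast
    have "closedin X (x ` P)"
      using closedin_Hausdorff_finite[OF assms(1) sub] assms(4) by simp
    then have "openin X (topspace X - x ` P)" by blast
    moreover have "p \<in> topspace X - x ` P" using x assms(2) by auto
    ultimately obtain U where "U \<in> P" "U \<subseteq> topspace X - x ` P"
      using local_pi_baseD(3)[OF assms(3)] by blast
    then show False using x by blast
  qed
  then have "local_base X p {{p}}" by (intro local_baseI) auto
  moreover have "omega_op_like {{p}}" unfolding omega_op_like_def by simp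
  ultimately show ?thesis unfolding chiNt_omega_def by blast
qed

lemma chiNt_omega_if_nowhere_accumulating_neighbourhoods:
  assumes "p \<in> topspace X" "local_base X p B" "|B| \<le>o |K|"
    and V: "\<And>k. k \<in> K \<Longrightarrow> openin X (V k) \<and> p \<in> V k"
    and fin: "\<And>U. openin X U \<Longrightarrow> p \<in> U \<Longrightarrow> finite {k \<in> K. U \<subseteq> V k}"
  shows "chiNt_omega X p"
proof -
  have "\<exists>U\<in>B. U \<subseteq> topspace X"
    using local_baseD(3)[OF assms(2) openin_topspace assms(1)] .
  then have "B \<noteq> {}" by blast
  \<comment> \<open>\<open>g\<close> lists \<open>B\<close>, possibly with repetitions. Each
    \<open>V k\<close> thus shrinks into one base member, and every base member gets its
    turn.\<close>
  then obtain g where g: "g ` K = B" using assms(3) card_of_ordLeq2 by metis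
  define C where "C = (\<lambda>k. V k \<inter> g k) ` K"
  have gB: "openin X (g k) \<and> p \<in> g k" if "k \<in> K" for k
    using g that local_baseD(1,2)[OF assms(2)] by auto
  have open_C: "openin X U \<and> p \<in> U" if "U \<in> C" for U
    using that gB V unfolding C_def by auto
  have "\<exists>U\<in>C. U \<subseteq> W" if W: "openin X W" "p \<in> W" for W
  proof -
    obtain U where "U \<in> B" "U \<subseteq> W" using local_baseD(3)[OF assms(2) W] by blast
    then obtain k where "k \<in> K" "g k \<subseteq> W" using g by blast
    then have "V k \<inter> g k \<in> C" "V k \<inter> g k \<subseteq> W" unfolding C_def by auto
    then show ?thesis ..
  qed
  with open_C have "local_base X p C" by (intro local_baseI) auto
  moreover have "omega_op_like C"
    unfolding omega_op_like_def
  proof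
    fix U assume "U \<in> C"
    then have fin_U: "finite {k \<in> K. U \<subseteq> V k}" using fin open_C by simp
    have "{M \<in> C. U \<subseteq> M} \<subseteq> (\<lambda>k. V k \<inter> g k) ` {k \<in> K. U \<subseteq> V k}" unfolding C_def by auto
    then show "finite {M \<in> C. U \<subseteq> M}" using fin_U by (rule finite_surj[rotated])
  qed
  ultimately show ?thesis unfolding chiNt_omega_def by blast
qed

section \<open>Finite choices, maxima and cardinal bounds\<close>

lemma finite_inj_choice:
  assumes "finite T" "\<And>p. p \<in> T \<Longrightarrow> infinite (S p)"
  shows "\<exists>h. inj_on h T \<and> (\<forall>p\<in>T. h p \<in> S p)"
  using assms
proof (induction T rule: finite_induct)
  case empty
  then show ?case by simp
next
  case (insert p T)
  then obtain h where h: "inj_on h T" "\<forall>p\<in>T. h p \<in> S p" by auto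
  have "infinite (S p - h ` T)" using insert by simp
  then obtain s where s: "s \<in> S p" "s \<notin> h ` T" using infinite_imp_nonempty by blast
  have "inj_on (h(p := s)) (insert p T)"
    using h(1) s(2) insert.hyps(2) by (auto simp: inj_on_def)
  moreover have "\<forall>q\<in>insert p T. (h(p := s)) q \<in> S q" using h(2) s(1) by auto
  ultimately show ?case by blast
qed

lemma finite_Linear_order_max:
  assumes "finite L" "L \<noteq> {}" "L \<subseteq> Field r" "Linear_order r"
  shows "\<exists>m\<in>L. \<forall>l\<in>L. (l, m) \<in> r"
proof -
  have refl: "(x, x) \<in> r" if "x \<in> Field r" for x
    using assms(4) that unfolding order_on_defs by (simp add: refl_on_def)
  have tr: "trans r" and tot: "Total r" using assms(4) unfolding order_on_defs by simp_all
  show ?thesis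
    using assms(1-3)
  proof (induction L rule: finite_ne_induct)
    case (singleton x)
    then show ?case using refl by simp
  next
    case (insert x L)
    then obtain m where m: "m \<in> L" "\<forall>l\<in>L. (l, m) \<in> r" by auto
    have F: "x \<in> Field r" "m \<in> Field r" using insert.prems m(1) by auto
    have "(x, m) \<in> r \<or> (m, x) \<in> r"
      using tot F refl unfolding total_on_def by metis
    then show ?case
    proof
      assume "(x, m) \<in> r"
      then show ?thesis using m by auto
    next
      assume "(m, x) \<in> r"
      then have "\<forall>l\<in>L. (l, x) \<in> r" using m(2) transD[OF tr] by metis
      then show ?thesis using refl[OF F(1)] by auto
    qed
  qed
qed

text \<open>If the union is infinite then so is \<open>J\<close>, and finite pieces give a union of
  size at most \<open>|J|\<close>; passing to finite subsets does not enlarge it. Since the pieces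
  are finite, singular \<open>|K|\<close> causes no trouble.\<close>

lemma card_of_Fpow_UNION_finite_ordLess:
  assumes "infinite K" "|J| <o |K|" "\<And>j. j \<in> J \<Longrightarrow> finite (f j)"
  shows "|Fpow (\<Union>j\<in>J. f j)| <o |K|"
proof (cases "finite (\<Union>j\<in>J. f j)")
  case True
  then have "finite (Fpow (\<Union>j\<in>J. f j))" by (simp add: Fpow_def)
  then show ?thesis using assms(1) finite_ordLess_infinite2 by blast
next
  case False
  then have J: "infinite J" using assms(3) by blast
  have "|f j| \<le>o |J|" if "j \<in> J" for j
    using assms(3)[OF that] J ordLess_imp_ordLeq finite_ordLess_infinite2 by blast
  then have "|\<Union>j\<in>J. f j| \<le>o |J|"
    by (intro card_of_UNION_ordLeq_infinite[OF J] ballI) simp_all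
  then show ?thesis
    using card_of_Fpow_infinite[OF False] assms(2)
    by (meson ordIso_ordLeq_trans ordLeq_ordLess_trans)
qed

section \<open>The recursive construction of covers\<close>

lemma finite_cover_refuting_local_pi_base:
  assumes X: "compactum X"
    and \<U>: "\<And>U. U \<in> \<U> \<Longrightarrow> openin X U \<and> U \<noteq> {}"
    and not_pi: "\<And>p. p \<in> topspace X \<Longrightarrow> \<not> local_pi_base X p \<U>"
  shows "\<exists>\<W>. finite \<W> \<and> (\<forall>W\<in>\<W>. openin X W) \<and> topspace X \<subseteq> \<Union>\<W> \<and>
           (\<forall>W\<in>\<W>. \<forall>U\<in>\<U>. \<not> U \<subseteq> X closure_of W)"
proof -
  have reg: "regular_space X" and comp: "compact_space X"
    using X compact_Hausdorff_imp_regular_space unfolding compactum_def by blast+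
  define \<C> where "\<C> = {W. openin X W \<and> (\<forall>U\<in>\<U>. \<not> U \<subseteq> X closure_of W)}"
  have "\<exists>W\<in>\<C>. p \<in> W" if p: "p \<in> topspace X" for p
  proof -
    \<comment> \<open>The members of \<open>\<U>\<close> are open and nonempty, so the failure at
      \<open>p\<close> must come from a neighbourhood \<open>G\<close> containing none of them.
      Regularity then gives \<open>W\<close> around \<open>p\<close> with closure inside
      \<open>G\<close>.\<close>
    obtain G where G: "openin X G" "p \<in> G" "\<And>U. U \<in> \<U> \<Longrightarrow> \<not> U \<subseteq> G"
      using not_pi[OF p] local_pi_baseI[of \<U> X p] \<U> by metis
    then obtain W C where W: "openin X W" "closedin X C" "p \<in> W" "W \<subseteq> C" "C \<subseteq> G"
      using reg unfolding neighbourhood_base_of_closedin[symmetric] neighbourhood_base_of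
      by meson
    have "X closure_of W \<subseteq> G" using W closure_of_minimal by (metis order_trans)
    then have "W \<in> \<C>" using W(1) G(3) unfolding \<C>_def by blast
    then show ?thesis using W(3) by blast
  qed
  then have "topspace X \<subseteq> \<Union>\<C>" by blast
  then obtain \<W> where "finite \<W>" "\<W> \<subseteq> \<C>" "topspace X \<subseteq> \<Union>\<W>"
    using comp unfolding compact_space_alt \<C>_def by (metis (no_types, lifting) mem_Collect_eq)
  then show ?thesis unfolding \<C>_def by blast
qed

text \<open>The lower bound \<open>pi\<close> on \<pi>-characters drives the choice of covers; the
  upper bound \<open>base\<close> on characters turns the neighbourhoods found at one point into a
  local base.\<close>

lemma exists_chiNt_omega_point:
  fixes X :: "'a topology" and K :: "'k set"
  assumes X: "compactum X" and ne: "topspace X \<noteq> {}" and K: "infinite K"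
    and base: "\<And>p. p \<in> topspace X \<Longrightarrow> \<exists>B. local_base X p B \<and> |B| \<le>o |K|"
    and pi: "\<And>p P. p \<in> topspace X \<Longrightarrow> local_pi_base X p P \<Longrightarrow> |K| \<le>o |P|"
  shows "\<exists>p\<in>topspace X. chiNt_omega X p"
proof -
  define r where "r = |K|"
  define R where "R = r - Id"
  have wo: "Well_order r" and co: "Card_order r" and Fr: "Field r = K"
    unfolding r_def by (simp_all add: card_of_Well_order card_of_Card_order)
  have wfR: "wf R" using wo unfolding R_def well_order_on_def by blast
  define res where "res \<G> = topspace X - (\<Union>W\<in>\<G>. X closure_of W)" for \<G>
  define prev where "prev f k = (\<Union>j\<in>{j. (j, k) \<in> R}. f j)" for f :: "'k \<Rightarrow> 'a set set" and k
  \<comment> \<open>\<open>f\<close> enters only through its values at strict predecessors of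
    \<open>k\<close>, as well-founded choice requires.\<close>
  define good where "good f k \<W> \<longleftrightarrow>
      finite \<W> \<and> (\<forall>W\<in>\<W>. openin X W) \<and> topspace X \<subseteq> \<Union>\<W> \<and>
      (\<forall>W\<in>\<W>. \<forall>\<G>\<in>Fpow (prev f k). res \<G> \<noteq> {} \<longrightarrow> \<not> res \<G> \<subseteq> X closure_of W)"
    for f k \<W>
  have "\<exists>f. \<forall>k. good f k (f k)"
  proof (rule dependent_wf_choice[OF wfR])
    fix f g :: "'k \<Rightarrow> 'a set set" and k \<W>
    assume "\<And>z. (z, k) \<in> R \<Longrightarrow> f z = g z"
    then have "prev f k = prev g k" unfolding prev_def by auto
    then show "good f k \<W> = good g k \<W>" unfolding good_def by simp
  next
    fix k and f :: "'k \<Rightarrow> 'a set set"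
    assume IH: "\<And>j. (j, k) \<in> R \<Longrightarrow> good f j (f j)"
    define \<U> where "\<U> = {U \<in> res ` Fpow (prev f k). U \<noteq> {}}"
    \<comment> \<open>\<open>r\<close> is a cardinal order, so its proper initial segments are
      smaller than \<open>K\<close>; an index outside \<open>K\<close> has no predecessors.\<close>
    have J: "|{j. (j, k) \<in> R}| <o |K|"
    proof (cases "k \<in> K")
      case True
      have "{j. (j, k) \<in> R} = underS r k" unfolding R_def underS_def by auto
      then show ?thesis using card_of_underS[OF co] True Fr unfolding r_def by auto
    next
      case False
      then have "{j. (j, k) \<in> R} = {}" using Fr unfolding R_def Field_def by auto
      then show ?thesis using K finite_ordLess_infinite2[of "{}" K] by simp
    qed
    have "|\<U>| \<le>o |res ` Fpow (prev f k)|" unfolding \<U>_def by (intro card_of_mono1) auto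
    also have "|res ` Fpow (prev f k)| \<le>o |Fpow (prev f k)|" by (rule card_of_image)
    also have "|Fpow (prev f k)| <o |K|"
      unfolding prev_def
      by (rule card_of_Fpow_UNION_finite_ordLess[OF K J]) (use IH good_def in auto)
    finally have small: "|\<U>| <o |K|" .
    have "\<exists>\<W>. finite \<W> \<and> (\<forall>W\<in>\<W>. openin X W) \<and> topspace X \<subseteq> \<Union>\<W> \<and>
           (\<forall>W\<in>\<W>. \<forall>U\<in>\<U>. \<not> U \<subseteq> X closure_of W)"
      (is "\<exists>\<W>. ?Q \<W>")
    proof (rule finite_cover_refuting_local_pi_base[OF X])
      fix U assume "U \<in> \<U>"
      then obtain \<G> where "finite \<G>" "U = res \<G>" "U \<noteq> {}"
        unfolding \<U>_def Fpow_def by blast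
      moreover have "closedin X (\<Union>W\<in>\<G>. X closure_of W)"
        using \<open>finite \<G>\<close> by (intro closedin_Union) auto
      ultimately show "openin X U \<and> U \<noteq> {}" unfolding res_def by blast
    next
      fix p assume "p \<in> topspace X"
      then show "\<not> local_pi_base X p \<U>" using pi small not_ordLess_ordLeq by blast
    qed
    then obtain \<W> where "?Q \<W>" ..
    then have "good f k \<W>" unfolding good_def \<U>_def by simp
    then show "\<exists>\<W>. good f k \<W>" ..
  qed
  then obtain f where f: "\<And>k. good f k (f k)" by auto
  have f_open: "openin X W" if "W \<in> f k" for W k
    using f[of k] that unfolding good_def by simp
  have f_cover: "topspace X \<subseteq> \<Union>(f k)" for k
    using f[of k] unfolding good_def by simp
  have f_split: "\<not> res \<G> \<subseteq> X closure_of W"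
    if "W \<in> f k" "\<G> \<in> Fpow (prev f k)" "res \<G> \<noteq> {}" for W \<G> k
    using f[of k] that unfolding good_def by simp
  \<comment> \<open>Induction on the finite index set, splitting off its largest index.\<close>
  have res_ne: "res (w ` L) \<noteq> {}"
    if "finite L" "L \<subseteq> K" "\<And>k. k \<in> L \<Longrightarrow> w k \<in> f k" for L w
    using that
  proof (induction "card L" arbitrary: L)
    case 0
    then show ?case using ne unfolding res_def by simp
  next
    case (Suc n)
    then have "L \<noteq> {}" by auto
    then obtain m where m: "m \<in> L" "\<forall>l\<in>L. (l, m) \<in> r"
      using finite_Linear_order_max[of L r] Suc.prems Fr wo unfolding well_order_on_def by auto
    define L' where "L' = L - {m}"
    \<comment> \<open>All indices in \<open>L'\<close> lie strictly below \<open>m\<close>, so their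
      sets come from covers chosen before the one at \<open>m\<close>.\<close>
    have "w ` L' \<in> Fpow (prev f m)"
      using Suc.prems m unfolding L'_def Fpow_def prev_def R_def by auto
    moreover have "res (w ` L') \<noteq> {}"
      using Suc m(1) unfolding L'_def by (intro Suc.hyps(1)) auto
    \<comment> \<open>A point of \<open>res (w\<close>
      L')\<open>outside this closure survives in\<close>res (w \<open>L)\<close>.\<close>
    ultimately have "\<not> res (w ` L') \<subseteq> X closure_of (w m)"
      using f_split[OF Suc.prems(3)[OF m(1)]] by simp
    moreover have "L = insert m L'" using m(1) unfolding L'_def by auto
    ultimately show ?case unfolding res_def by auto
  qed
  have "\<exists>W\<in>f k. p \<in> W" if "p \<in> topspace X" for p k
    using f_cover[of k] that by auto
  then obtain V where V: "\<And>p k. p \<in> topspace X \<Longrightarrow> V p k \<in> f k \<and> p \<in> V p k" by metis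
  have V_open: "openin X (V p k)" if "p \<in> topspace X" for p k
    using f_open V[OF that] by blast
  have "\<exists>p\<in>topspace X. \<forall>U. openin X U \<and> p \<in> U \<longrightarrow> finite {k \<in> K. U \<subseteq> V p k}"
  proof (rule ccontr)
    assume "\<not> ?thesis"
    then obtain U where U: "\<And>p. p \<in> topspace X \<Longrightarrow>
        openin X (U p) \<and> p \<in> U p \<and> infinite {k \<in> K. U p \<subseteq> V p k}" by metis
    have "\<exists>\<F>. finite \<F> \<and> \<F> \<subseteq> U ` topspace X \<and> topspace X \<subseteq> \<Union>\<F>"
    proof -
      have "\<forall>G\<in>U ` topspace X. openin X G" "topspace X \<subseteq> \<Union>(U ` topspace X)" using U by auto
      then show ?thesis using X unfolding compactum_def compact_space_alt by simp
    qed
    then obtain T where T: "finite T" "T \<subseteq> topspace X" "topspace X \<subseteq> (\<Union>p\<in>T. U p)"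
      by (metis finite_subset_image)
    \<comment> \<open>Distinct indices are essential: \<open>res_ne\<close> allows just one set from
      each cover. Injectivity lets \<open>w\<close> recover the point of \<open>T\<close> from its
      index.\<close>
    obtain h where h: "inj_on h T" "\<And>p. p \<in> T \<Longrightarrow> h p \<in> {k \<in> K. U p \<subseteq> V p k}"
      using finite_inj_choice[OF T(1), of "\<lambda>p. {k \<in> K. U p \<subseteq> V p k}"] U T(2) by (metis subsetD)
    define w where "w k = V (the_inv_into T h k) k" for k
    have w: "w (h p) = V p (h p)" if "p \<in> T" for p
      using the_inv_into_f_f[OF h(1) that] unfolding w_def by simp
    have "res (w ` h ` T) \<noteq> {}"
    proof (rule res_ne)
      show "finite (h ` T)" using T(1) by simp
      show "h ` T \<subseteq> K" using h(2) by auto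
      fix k assume "k \<in> h ` T"
      then obtain p where "p \<in> T" "k = h p" by auto
      then show "w k \<in> f k" using w V T(2) by auto
    qed
    \<comment> \<open>\<open>q\<close> avoids every \<open>V p (h p)\<close> with \<open>p\<close>
      in \<open>T\<close>, yet lies in some \<open>U p\<close>, which is contained in
      \<open>V p (h p)\<close>.\<close>
    then obtain q where q: "q \<in> topspace X" "\<And>k. k \<in> h ` T \<Longrightarrow> q \<notin> X closure_of w k"
      unfolding res_def by auto
    obtain p where p: "p \<in> T" "q \<in> U p" using T(3) q(1) by blast
    then have "q \<in> V p (h p)" using h(2)[OF p(1)] by auto
    moreover have "V p (h p) \<subseteq> X closure_of V p (h p)"
      using V_open p(1) T(2) by (intro closure_of_subset openin_subset) auto
    ultimately show False using q(2)[of "h p"] p(1) w[OF p(1)] by auto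
  qed
  then obtain p where p: "p \<in> topspace X"
    and fin: "\<And>U. openin X U \<Longrightarrow> p \<in> U \<Longrightarrow> finite {k \<in> K. U \<subseteq> V p k}" by blast
  obtain B where "local_base X p B" "|B| \<le>o |K|" using base[OF p] by blast
  then have "chiNt_omega X p"
    using chiNt_omega_if_nowhere_accumulating_neighbourhoods[OF p, of B K "V p"] V V_open p fin
    by blast
  with p show ?thesis by blast
qed

section \<open>Invariance under homeomorphisms\<close>

lemma local_base_homeomorphic_image:
  assumes f: "homeomorphic_map X Y f" and p: "p \<in> topspace X" and B: "local_base X p B"
  shows "local_base Y (f p) ((`) f ` B)"
proof -
  have op: "openin Y (f ` U)" if "openin X U" for U
    using homeomorphic_imp_open_map[OF f] that unfolding open_map_def by simp
  have "\<exists>U\<in>(`) f ` B. U \<subseteq> W" if W: "openin Y W" "f p \<in> W" for W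
  proof -
    have "openin X {x \<in> topspace X. f x \<in> W}"
      using homeomorphic_imp_continuous_map[OF f] W(1) openin_continuous_map_preimage by blast
    then obtain U where "U \<in> B" "U \<subseteq> {x \<in> topspace X. f x \<in> W}"
      using local_baseD(3)[OF B, of "{x \<in> topspace X. f x \<in> W}"] p W(2) by auto
    then show ?thesis by blast
  qed
  then show ?thesis using op local_baseD(1,2)[OF B] by (intro local_baseI) auto
qed

lemma local_pi_base_homeomorphic_image:
  assumes f: "homeomorphic_map X Y f" and p: "p \<in> topspace X" and B: "local_pi_base X p B"
  shows "local_pi_base Y (f p) ((`) f ` B)"
proof -
  have op: "openin Y (f ` U)" if "openin X U" for U
    using homeomorphic_imp_open_map[OF f] that unfolding open_map_def by simp
  have "\<exists>U\<in>(`) f ` B. U \<subseteq> W" if W: "openin Y W" "f p \<in> W" for W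
  proof -
    have "openin X {x \<in> topspace X. f x \<in> W}"
      using homeomorphic_imp_continuous_map[OF f] W(1) openin_continuous_map_preimage by blast
    then obtain U where "U \<in> B" "U \<subseteq> {x \<in> topspace X. f x \<in> W}"
      using local_pi_baseD(3)[OF B, of "{x \<in> topspace X. f x \<in> W}"] p W(2) by auto
    then show ?thesis by blast
  qed
  then show ?thesis using op local_pi_baseD(1,2)[OF B] by (intro local_pi_baseI) force+
qed

lemma chiNt_omega_homeomorphic_image:
  assumes f: "homeomorphic_map X Y f" and p: "p \<in> topspace X" and "chiNt_omega X p"
  shows "chiNt_omega Y (f p)"
proof -
  obtain B where B: "local_base X p B" "omega_op_like B"
    using assms(3) unfolding chiNt_omega_def by blast
  have sub: "U \<subseteq> topspace X" if "U \<in> B" for U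
    using local_baseD(1)[OF B(1) that] by (rule openin_subset)
  have "finite {V \<in> (`) f ` B. f ` U \<subseteq> V}" if "U \<in> B" for U
  proof (rule finite_subset)
    show "{V \<in> (`) f ` B. f ` U \<subseteq> V} \<subseteq> (`) f ` {V \<in> B. U \<subseteq> V}"
      using inj_on_image_subset_iff[OF homeomorphic_imp_injective_map[OF f]] sub that by auto
    show "finite ((`) f ` {V \<in> B. U \<subseteq> V})"
      using B(2) that unfolding omega_op_like_def by simp
  qed
  then have "omega_op_like ((`) f ` B)" unfolding omega_op_like_def by blast
  then show ?thesis
    using local_base_homeomorphic_image[OF f p B(1)] unfolding chiNt_omega_def by blast
qed

section \<open>From the cardinal hypotheses to the two statements\<close>

lemma card_of_ordLeq_card_plus_omega: "|F| \<le>o card_plus_omega F"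
  unfolding card_plus_omega_def by (rule card_of_Plus1)

lemma card_plus_omega_ordIso_card_of:
  assumes "infinite F"
  shows "card_plus_omega F =o |F|"
proof -
  have "|UNIV :: nat set| \<le>o |F|" using assms infinite_iff_card_of_nat by blast
  then show ?thesis
    unfolding card_plus_omega_def using card_of_Plus_infinite1[OF assms] by blast
qed

lemma exists_chiNt_omega_if_pichar_eq_char:
  assumes X: "compactum X" and ne: "topspace X \<noteq> {}"
    and eq: "\<And>p q. p \<in> topspace X \<Longrightarrow> q \<in> topspace X \<Longrightarrow> pichar_eq_char X p q"
  shows "\<exists>p\<in>topspace X. chiNt_omega X p"
proof (cases "\<exists>p\<in>topspace X. \<exists>P. local_pi_base X p P \<and> finite P")
  case True
  then show ?thesis
    using chiNt_omega_if_finite_local_pi_base X[unfolded compactum_def] by metis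
next
  \<comment> \<open>Every local \<pi>-base is now infinite, so the added \<omega> is absorbed on the
    \<pi>-character side.\<close>
  case False
  obtain c where c: "c \<in> topspace X" using ne by blast
  obtain K where K: "local_pi_base X c K" "\<And>P. local_pi_base X c P \<Longrightarrow> |K| \<le>o |P|"
    using exists_minimal_local_pi_base[of X c] by auto
  show ?thesis
  proof (rule exists_chiNt_omega_point[OF X ne])
    show "infinite K" using False K(1) c by blast
  next
    fix q assume q: "q \<in> topspace X"
    obtain P B where PB: "local_pi_base X c P"
        "\<forall>P'. local_pi_base X c P' \<longrightarrow> |P| \<le>o |P'|" "local_base X q B"
        "card_plus_omega P =o card_plus_omega B"
      using eq[OF c q] unfolding pichar_eq_char_def by (elim exE conjE) (rule that)
    have "infinite P" using False c PB(1) by blast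
    have "|B| \<le>o card_plus_omega B" by (rule card_of_ordLeq_card_plus_omega)
    also have "card_plus_omega B =o card_plus_omega P" using PB(4) by (rule ordIso_symmetric)
    also have "card_plus_omega P =o |P|"
      using \<open>infinite P\<close> by (rule card_plus_omega_ordIso_card_of)
    also have "|P| \<le>o |K|" using PB(2) K(1) by simp
    finally show "\<exists>B. local_base X q B \<and> |B| \<le>o |K|" using PB(3) by blast
  next
    fix p P' assume p: "p \<in> topspace X" and P': "local_pi_base X p P'"
    obtain P B where PB: "local_pi_base X p P"
        "\<forall>P'. local_pi_base X p P' \<longrightarrow> |P| \<le>o |P'|" "local_base X c B"
        "card_plus_omega P =o card_plus_omega B"
      using eq[OF p c] unfolding pichar_eq_char_def by (elim exE conjE) (rule that)
    have "infinite P" using False p PB(1) by blast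
    \<comment> \<open>The chain is \<pi>\<chi>(c,X) \<le> \<chi>(c,X) = \<pi>\<chi>(p,X).\<close>
    have "|K| \<le>o |B|" using K(2)[OF local_base_imp_local_pi_base[OF PB(3)]] .
    also have "|B| \<le>o card_plus_omega B" by (rule card_of_ordLeq_card_plus_omega)
    also have "card_plus_omega B =o card_plus_omega P" using PB(4) by (rule ordIso_symmetric)
    also have "card_plus_omega P =o |P|"
      using \<open>infinite P\<close> by (rule card_plus_omega_ordIso_card_of)
    also have "|P| \<le>o |P'|" using PB(2) P' by simp
    finally show "|K| \<le>o |P'|" .
  qed
qed

lemma exists_chiNt_omega_if_homogeneous:
  fixes X :: "'a topology"
  assumes X: "compactum X" and ne: "topspace X \<noteq> {}" and hom: "homogeneous_space X"
    and eq: "pichar_space_eq_char_space X"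
  shows "\<exists>p\<in>topspace X. chiNt_omega X p"
proof (cases "\<exists>p\<in>topspace X. \<exists>P. local_pi_base X p P \<and> finite P")
  case True
  then show ?thesis
    using chiNt_omega_if_finite_local_pi_base X[unfolded compactum_def] by metis
next
  case False
  obtain c where c: "c \<in> topspace X" using ne by blast
  obtain K where K: "local_pi_base X c K" "\<And>P. local_pi_base X c P \<Longrightarrow> |K| \<le>o |P|"
    using exists_minimal_local_pi_base[of X c] by auto
  \<comment> \<open>A copy of \<open>K\<close> in the type over which
    \<open>pichar_space_eq_char_space\<close> quantifies. Homogeneity makes it bound all
    \<pi>-characters, hence all characters.\<close>
  define K' where "K' = {0 :: nat} \<times> K"
  have "bij_betw snd K' K" unfolding K'_def by (auto simp: bij_betw_def inj_on_def)
  then have KK': "|K'| =o |K|" using card_of_ordIso by blast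
  have "pichar_space_le X K'"
    unfolding pichar_space_le_def
  proof
    fix q assume q: "q \<in> topspace X"
    obtain f where f: "homeomorphic_map X X f" "f c = q"
      using hom c q unfolding homogeneous_space_def by blast
    define P where "P = (`) f ` K"
    have P: "local_pi_base X q P"
      using local_pi_base_homeomorphic_image[OF f(1) c K(1)] f(2) unfolding P_def by simp
    then have "infinite P" using False q by blast
    then have "card_plus_omega P =o |P|" by (rule card_plus_omega_ordIso_card_of)
    also have "|P| \<le>o |K|" unfolding P_def by (rule card_of_image)
    also have "|K| =o |K'|" using KK' by (rule ordIso_symmetric)
    finally show "\<exists>P. local_pi_base X q P \<and> card_plus_omega P \<le>o |K'|" using P by blast
  qed
  then have ch: "char_space_le X K'" using eq unfolding pichar_space_eq_char_space_def by simp
  show ?thesis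
  proof (rule exists_chiNt_omega_point[OF X ne])
    show "infinite K" using False K(1) c by blast
  next
    fix q assume "q \<in> topspace X"
    then obtain B where B: "local_base X q B" "card_plus_omega B \<le>o |K'|"
      using ch unfolding char_space_le_def by blast
    have "|B| \<le>o card_plus_omega B" by (rule card_of_ordLeq_card_plus_omega)
    also note B(2)
    also note KK'
    finally show "\<exists>B. local_base X q B \<and> |B| \<le>o |K|" using B(1) by blast
  next
    fix p P assume p: "p \<in> topspace X" and P: "local_pi_base X p P"
    obtain f where f: "homeomorphic_map X X f" "f p = c"
      using hom c p unfolding homogeneous_space_def by blast
    have "|K| \<le>o |(`) f ` P|"
      using K(2) local_pi_base_homeomorphic_image[OF f(1) p P] f(2) by simp
    also have "|(`) f ` P| \<le>o |P|" by (rule card_of_image)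
    finally show "|K| \<le>o |P|" .
  qed
qed

theorem theorem2p14:
  fixes X :: "'a topology"
  shows "(compactum X \<and> topspace X \<noteq> {} \<and> (\<forall>p\<in>topspace X. \<forall>q\<in>topspace X. pichar_eq_char X p q)
            \<longrightarrow> (\<exists>p\<in>topspace X. chiNt_omega X p))
       \<and> (compactum X \<and> homogeneous_space X \<and> pichar_space_eq_char_space X
            \<longrightarrow> (\<forall>p\<in>topspace X. chiNt_omega X p))"
proof (intro conjI impI ballI)
  assume "compactum X \<and> topspace X \<noteq> {} \<and>
    (\<forall>p\<in>topspace X. \<forall>q\<in>topspace X. pichar_eq_char X p q)"
  then show "\<exists>p\<in>topspace X. chiNt_omega X p"
    using exists_chiNt_omega_if_pichar_eq_char by blast
next
  fix p
  assume A: "compactum X \<and> homogeneous_space X \<and> pichar_space_eq_char_space X"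
    and p: "p \<in> topspace X"
  \<comment> \<open>\<open>p\<close> itself shows that the space is nonempty; homogeneity then
    carries the property from \<open>q\<close> to \<open>p\<close>.\<close>
  then obtain q where q: "q \<in> topspace X" "chiNt_omega X q"
    using exists_chiNt_omega_if_homogeneous by blast
  obtain f where "homeomorphic_map X X f" "f q = p"
    using A p q(1) unfolding homogeneous_space_def by blast
  then show "chiNt_omega X p" using chiNt_omega_homeomorphic_image[OF _ q] by blast
qed

end
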